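(* Let $d\ge2$ and $\alpha\in[1,\infty)$. For any set $E$ in $\mathbb R^d$ with finite restricted $\alpha$-Hermite perimeter, $$\widetilde P_{\mathcal H_\alpha}(E)=\widetilde P_{\mathcal H_\alpha}(E^c),$$ where $E^c=\mathbb R^d\setminus E$.
   Context: For $i=1,\dots,d$ put $A^{\pm}_{i,\alpha}=\partial_{x_i}\pm\sqrt{\alpha-1}\,x_i|x|^{(\alpha-2)/2}$ (the second term acting by multiplication). For $\varphi=(\varphi_1,\dots,\varphi_{2d})\in C^1(\mathbb R^d;\mathbb R^{2d})$, $$\mathrm{div}_{\mathcal H_\alpha}\varphi=A^+_{d,\alpha}\varphi_1+\cdots+A^+_{1,\alpha}\varphi_d+A^-_{1,\alpha}\varphi_{d+1}+\cdots+A^-_{d,\alpha}\varphi_{2d}.$$ $\mathcal F_R(\mathbb R^d)$ is the class of $\varphi\in C^1_c(\mathbb R^d;\mathbb R^{2d})$ with $\sup_x(|\varphi_1(x)|^2+\cdots+|\varphi_{2d}(x)|^2)^{1/2}\le1$ and $$\int_{\mathbb R^d}\Big[\sum_{k=1}^d\sqrt{\alpha-1}\,x_k|x|^{(\alpha-2)/2}\varphi_{d-k+1}(x)-\sum_{k=1}^d\sqrt{\alpha-1}\,x_k|x|^{(\alpha-2)/2}\varphi_{d+k}(x)\Big]dx=0 .$$ The restricted $\alpha$-Hermite perimeter of a (measurable) set $E\subseteq\mathbb R^d$ is $\widetilde P_{\mathcal H_\alpha}(E)=\sup_{\varphi\in\mathcal F_R(\mathbb R^d)}\int_E\mathrm{div}_{\mathcal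 H_\alpha}\varphi(x)\,dx$. *)

theory Defs
  imports "HOL-Analysis.Analysis"
begin

text \<open>
  The space \<open>\<real>\<^sup>d\<close> is \<^typ>\<open>real ^ 'd\<close> with \<open>d = CARD('d)\<close>. The divergence pairs the components of
  a vector field with the coordinates in reversed order, so a numbering of the index type is
  needed: \<open>e\<close> is a bijection from \<open>{1..d}\<close> onto \<^typ>\<open>'d\<close>, and the \<open>k\<close>-th coordinate of \<open>x\<close> is
  \<open>x $ e k\<close>. The space \<open>\<real>\<^sup>2\<^sup>d\<close> is \<open>real ^ ('d + 'd)\<close>, whose components number \<open>1, \<dots>, d\<close> are the
  left and \<open>d + 1, \<dots>, 2d\<close> the right summands.
\<close>

definition cmp :: "(nat \<Rightarrow> 'd) \<Rightarrow> (real ^ 'd \<Rightarrow> real ^ ('d + 'd)) \<Rightarrow> nat \<Rightarrow> real ^ 'd \<Rightarrow> real"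
  where "cmp e \<phi> j x =
    \<phi> x $ (if j \<le> CARD('d) then Inl (e j) else Inr (e (j - CARD('d))))"

definition C1_fun :: "('a::real_normed_vector \<Rightarrow> 'b::real_normed_vector) \<Rightarrow> bool"
  where "C1_fun f \<longleftrightarrow>
    (\<exists>f' :: 'a \<Rightarrow> 'a \<Rightarrow>\<^sub>L 'b.
      (\<forall>x. (f has_derivative blinfun_apply (f' x)) (at x)) \<and> continuous_on UNIV f')"

definition partial_deriv :: "'d \<Rightarrow> (real ^ 'd \<Rightarrow> real) \<Rightarrow> real ^ 'd \<Rightarrow> real"
  where "partial_deriv i f x = deriv (\<lambda>t. f (x + t *\<^sub>R axis i 1)) 0"

text \<open>
  For \<open>\<alpha> < 2\<close> the function \<open>x\<^sub>i|x|\<^bsup>(\<alpha>-2)/2\<^esup>\<close> extends continuously by \<open>0\<close> to the origin; this is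
  the value given by the convention \<open>0 powr a = 0\<close>. For \<open>\<alpha> = 2\<close>, where \<open>|x|\<^sup>0\<close> should be \<open>1\<close>
  everywhere, the convention is harmless because of the factor \<open>x\<^sub>i\<close>.
\<close>

definition herm_coeff :: "real \<Rightarrow> 'd::finite \<Rightarrow> real ^ 'd \<Rightarrow> real"
  where "herm_coeff \<alpha> i x = sqrt (\<alpha> - 1) * x $ i * norm x powr ((\<alpha> - 2) / 2)"

definition A_plus :: "real \<Rightarrow> 'd::finite \<Rightarrow> (real ^ 'd \<Rightarrow> real) \<Rightarrow> real ^ 'd \<Rightarrow> real"
  where "A_plus \<alpha> i f x = partial_deriv i f x + herm_coeff \<alpha> i x * f x"

definition A_minus :: "real \<Rightarrow> 'd::finite \<Rightarrow> (real ^ 'd \<Rightarrow> real) \<Rightarrow> real ^ 'd \<Rightarrow> real"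
  where "A_minus \<alpha> i f x = partial_deriv i f x - herm_coeff \<alpha> i x * f x"

definition div_herm ::
    "(nat \<Rightarrow> 'd::finite) \<Rightarrow> real \<Rightarrow> (real ^ 'd \<Rightarrow> real ^ ('d + 'd)) \<Rightarrow> real ^ 'd \<Rightarrow> real"
  where "div_herm e \<alpha> \<phi> x =
    (\<Sum>k = 1..CARD('d). A_plus \<alpha> (e k) (cmp e \<phi> (CARD('d) - k + 1)) x) +
    (\<Sum>k = 1..CARD('d). A_minus \<alpha> (e k) (cmp e \<phi> (CARD('d) + k)) x)"

definition restricted_fields ::
    "(nat \<Rightarrow> 'd::finite) \<Rightarrow> real \<Rightarrow> (real ^ 'd \<Rightarrow> real ^ ('d + 'd)) set"
  where "restricted_fields e \<alpha> =
    {\<phi>. C1_fun \<phi> \<and> compact (closure {x. \<phi> x \<noteq> 0}) \<and> (SUP x. norm (\<phi> x)) \<le> 1 \<and>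
      (LINT x|lebesgue.
        (\<Sum>k = 1..CARD('d). herm_coeff \<alpha> (e k) x * cmp e \<phi> (CARD('d) - k + 1) x) -
        (\<Sum>k = 1..CARD('d). herm_coeff \<alpha> (e k) x * cmp e \<phi> (CARD('d) + k) x)) = 0}"

definition restricted_perimeter ::
    "(nat \<Rightarrow> 'd::finite) \<Rightarrow> real \<Rightarrow> (real ^ 'd) set \<Rightarrow> ereal"
  where "restricted_perimeter e \<alpha> E =
    (SUP \<phi> \<in> restricted_fields e \<alpha>. ereal (LINT x:E|lebesgue. div_herm e \<alpha> \<phi> x))"

end

theory Submission
  imports Defs
begin

text \<open>
  The divergence of an admissible field \<open>\<phi>\<close> has integral zero over the whole space. Its
  zeroth-order part is exactly the integrand of the constraint that defines the admissible class,
  and its first-order part is a sum of partial derivatives of compactly supported \<open>C\<^sup>1\<close> functions,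
  each of integral zero (\<open>partial_deriv_integral_zero\<close>). Hence the integral of the divergence
  of \<open>\<phi>\<close> over \<open>- E\<close> is the integral over \<open>E\<close> of the divergence of \<open>- \<phi>\<close>
  (\<open>set_integral_div_herm_Compl\<close>). As the admissible class is closed under negation, the two
  suprema range over the same set of numbers.

  Splitting the integral requires the divergence to be integrable, which rests on the continuity
  of the coefficients \<open>x\<^sub>i|x|\<^bsup>(\<alpha>-2)/2\<^esup>\<close>. At the origin this holds because they are bounded by
  \<open>|x|\<^bsup>\<alpha>/2\<^esup>\<close> and \<open>\<alpha> > 0\<close>.
\<close>

lemma C1_fun_continuous:
  assumes "C1_fun f"
  shows "continuous_on UNIV f"
  using assms unfolding C1_fun_def
  by (meson has_derivative_continuous continuous_at_imp_continuous_on)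

lemma C1_fun_bounded_linear_compose:
  assumes g: "bounded_linear g" and f: "C1_fun f"
  shows "C1_fun (\<lambda>x. g (f x))"
proof -
  obtain f' where f': "\<And>x. (f has_derivative blinfun_apply (f' x)) (at x)"
    and cont: "continuous_on UNIV f'"
    using f unfolding C1_fun_def by blast
  let ?G = "Blinfun g"
  have G: "blinfun_apply ?G = g"
    by (rule bounded_linear_Blinfun_apply[OF g])
  have "\<forall>x. ((\<lambda>x. g (f x)) has_derivative blinfun_apply (?G o\<^sub>L f' x)) (at x)"
    by (intro allI has_derivative_eq_rhs[OF bounded_linear.has_derivative[OF g f']])
       (simp add: G fun_eq_iff)
  moreover have "continuous_on UNIV (\<lambda>x. ?G o\<^sub>L f' x)"
    by (intro continuous_intros cont)
  ultimately show ?thesis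
    unfolding C1_fun_def by (intro exI[of _ "\<lambda>x. ?G o\<^sub>L f' x"] conjI)
qed

lemma partial_deriv_eq:
  assumes "(f has_derivative f') (at x)"
  shows "partial_deriv i f x = f' (axis i 1)"
proof -
  have lin: "bounded_linear f'"
    using assms by (rule has_derivative_bounded_linear)
  have "((\<lambda>t. f (x + t *\<^sub>R axis i 1)) has_derivative (\<lambda>t. f' (t *\<^sub>R axis i 1))) (at 0)"
    by (rule has_derivative_compose[where g = f and f = "\<lambda>t. x + t *\<^sub>R axis i 1"])
       (use assms in \<open>auto intro!: derivative_eq_intros\<close>)
  moreover have "(\<lambda>t. f' (t *\<^sub>R axis i 1)) = (*) (f' (axis i 1))"
    by (simp add: fun_eq_iff linear_simps(5)[OF lin])
  ultimately have "((\<lambda>t. f (x + t *\<^sub>R axis i 1)) has_field_derivative f' (axis i 1)) (at 0)"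
    by (simp add: has_field_derivative_def)
  then show ?thesis
    unfolding partial_deriv_def by (rule DERIV_imp_deriv)
qed

lemma integrable_continuous_compact_support:
  fixes f :: "'a::euclidean_space \<Rightarrow> real"
  assumes "continuous_on UNIV f" "compact K" "\<And>x. x \<notin> K \<Longrightarrow> f x = 0"
  shows "integrable lborel f"
proof -
  have "integrable lborel (\<lambda>x. indicator K x *\<^sub>R f x)"
    by (rule borel_integrable_compact) (use assms in \<open>auto intro: continuous_on_subset\<close>)
  moreover have "(\<lambda>x. indicator K x *\<^sub>R f x) = f"
    using assms(3) by (auto simp: fun_eq_iff indicator_def)
  ultimately show ?thesis
    by simp
qed

lemma integral_lborel_translation:
  fixes f :: "'a::euclidean_space \<Rightarrow> real"
  assumes [measurable]: "f \<in> borel_measurable borel"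
  shows "(LINT x|lborel. f (x + v)) = (LINT x|lborel. f x)"
proof -
  have "(LINT x|lborel. f x) = (LINT x|distr lborel borel ((+) v). f x)"
    by (simp add: lborel_distr_plus)
  also have "\<dots> = (LINT x|lborel. f (v + x))"
    by (rule integral_distr) simp_all
  finally show ?thesis
    by (simp add: add.commute)
qed

lemma has_derivative_zero_off_support:
  assumes f': "(f has_derivative f') (at x)" and K: "closed K"
    and zero: "\<And>x. x \<notin> K \<Longrightarrow> f x = 0" and x: "x \<notin> K"
  shows "f' = (\<lambda>_. 0)"
proof -
  have "(f has_derivative (\<lambda>_. 0)) (at x)"
    by (rule has_derivative_transform_within_open[of "\<lambda>_. 0" _ x UNIV "- K"])
       (use K zero x in auto)
  then show ?thesis
    using f' has_derivative_unique by blast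
qed

text \<open>
  The integral of \<open>n (f (x + v/n) - f x)\<close> vanishes for every \<open>n\<close> by
  translation invariance of the Lebesgue measure. These difference quotients converge pointwise to the
  derivative of \<open>f\<close> in direction \<open>v\<close> and are dominated by a multiple of the indicator of one ball,
  so the limit has integral zero as well.
\<close>

lemma integral_directional_derivative_zero:
  fixes f :: "'a::euclidean_space \<Rightarrow> real" and f' :: "'a \<Rightarrow> 'a \<Rightarrow>\<^sub>L real"
  assumes f': "\<And>x. (f has_derivative blinfun_apply (f' x)) (at x)"
    and cont: "continuous_on UNIV f'"
    and K: "compact K" and zero: "\<And>x. x \<notin> K \<Longrightarrow> f x = 0"
  shows "(LINT x|lborel. f' x v) = 0"
proof -
  have contf: "continuous_on UNIV f"
    using f' has_derivative_continuous continuous_at_imp_continuous_on by blast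
  then have [measurable]: "f \<in> borel_measurable borel"
    by (rule borel_measurable_continuous_onI)
  have intf: "integrable lborel f"
    by (rule integrable_continuous_compact_support[OF contf K zero])
  have intfs: "integrable lborel (\<lambda>x. f (x + w))" for w
  proof (rule integrable_continuous_compact_support)
    show "continuous_on UNIV (\<lambda>x. f (x + w))"
      by (rule continuous_on_compose2[OF contf]) (auto intro!: continuous_intros)
    show "compact ((\<lambda>x. x - w) ` K)"
      by (intro compact_continuous_image K continuous_intros)
    show "f (x + w) = 0" if "x \<notin> (\<lambda>x. x - w) ` K" for x
      using that zero[of "x + w"] by (force simp: image_iff)
  qed
  obtain R where R: "\<And>x. x \<in> K \<Longrightarrow> norm x \<le> R"
    using compact_imp_bounded[OF K] by (auto simp: bounded_iff)
  have "bounded (f' ` K)"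
    by (intro compact_imp_bounded compact_continuous_image K continuous_on_subset[OF cont]) auto
  then obtain B where B: "\<And>x. x \<in> K \<Longrightarrow> norm (f' x) \<le> B"
    by (auto simp: bounded_iff)
  have der_bound: "onorm (f' x) \<le> max B 0" for x
  proof (cases "x \<in> K")
    case True
    with B[OF this] show ?thesis by (simp add: norm_blinfun.rep_eq)
  next
    case False
    have "blinfun_apply (f' x) = (\<lambda>_. 0)"
      by (rule has_derivative_zero_off_support[OF f' compact_imp_closed[OF K] zero False])
    then show ?thesis by (simp add: onorm_zero)
  qed
  \<comment> \<open>The difference quotient of \<open>f\<close> in direction \<open>v\<close> with step \<open>1 / (n + 1)\<close>.\<close>
  define q where "q = (\<lambda>n x. (f (x + inverse (real (Suc n)) *\<^sub>R v) - f x) * real (Suc n))"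
  have qmeas [measurable]: "q n \<in> borel_measurable borel" for n
    unfolding q_def by measurable
  have lim: "(\<lambda>n. q n x) \<longlonglongrightarrow> f' x v" for x
  proof -
    have "((\<lambda>t. f (x + t *\<^sub>R v)) has_derivative (\<lambda>t. f' x (t *\<^sub>R v))) (at 0)"
      by (rule has_derivative_compose[where g = f and f = "\<lambda>t. x + t *\<^sub>R v"])
         (use f'[of x] in \<open>auto intro!: derivative_eq_intros\<close>)
    then have "((\<lambda>t. f (x + t *\<^sub>R v)) has_field_derivative f' x v) (at 0)"
      by (simp add: has_field_derivative_def blinfun.scaleR_right mult.commute[of _ "f' x v"])
    then have "((\<lambda>t. (f (x + t *\<^sub>R v) - f x) / t) \<longlongrightarrow> f' x v) (at 0)"
      by (simp add: DERIV_def)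
    moreover have "filterlim (\<lambda>n. inverse (real (Suc n))) (at 0) sequentially"
      by (rule filterlim_atI[OF LIMSEQ_inverse_real_of_nat]) simp
    ultimately have "(\<lambda>n. (f (x + inverse (real (Suc n)) *\<^sub>R v) - f x) / inverse (real (Suc n)))
        \<longlonglongrightarrow> f' x v"
      by (rule filterlim_compose)
    then show ?thesis
      by (simp add: q_def divide_inverse)
  qed
  \<comment> \<open>Steps have length at most \<open>norm v\<close>, so all difference quotients vanish outside the ball of
    radius \<open>R + norm v\<close>; inside, the mean value inequality bounds them.\<close>
  have dom: "norm (q n x) \<le> (max B 0 * norm v) * indicator (cball 0 (R + norm v)) x" for n x
  proof (cases "x \<in> cball 0 (R + norm v)")
    case True
    have "norm (f (x + inverse (real (Suc n)) *\<^sub>R v) - f x)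
        \<le> max B 0 * norm (x + inverse (real (Suc n)) *\<^sub>R v - x)"
      by (rule differentiable_bound[where S = UNIV and f' = "\<lambda>x. blinfun_apply (f' x)"])
         (use f' der_bound in auto)
    then have "norm (f (x + inverse (real (Suc n)) *\<^sub>R v) - f x) * real (Suc n)
        \<le> (max B 0 * norm (x + inverse (real (Suc n)) *\<^sub>R v - x)) * real (Suc n)"
      by (rule mult_right_mono) simp
    also have "\<dots> = max B 0 * norm v"
      by (simp add: field_simps)
    finally show ?thesis
      using True by (simp add: q_def abs_mult)
  next
    case False
    then have far: "R + norm v < norm x" by simp
    have "inverse (real (Suc n)) * norm v \<le> 1 * norm v"
      by (intro mult_right_mono) (auto simp: inverse_le_1_iff)
    moreover have "norm x \<le> norm (x + inverse (real (Suc n)) *\<^sub>R v) + norm (inverse (real (Suc n)) *\<^sub>R v)"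
      by (metis add_diff_cancel_right' norm_triangle_ineq4)
    ultimately have "R < norm (x + inverse (real (Suc n)) *\<^sub>R v)"
      using far by simp
    then have "x + inverse (real (Suc n)) *\<^sub>R v \<notin> K"
      using R by force
    moreover have "x \<notin> K"
      using R[of x] far norm_ge_zero[of v] by linarith
    ultimately show ?thesis
      using False zero by (simp add: q_def)
  qed
  have "(\<lambda>n. LINT x|lborel. q n x) \<longlonglongrightarrow> (LINT x|lborel. f' x v)"
  proof (rule integral_dominated_convergence)
    have "(\<lambda>x. f' x v) \<in> borel_measurable borel"
      by (intro borel_measurable_continuous_onI continuous_intros cont)
    then show "(\<lambda>x. f' x v) \<in> borel_measurable lborel" by simp
    show "integrable lborel (\<lambda>x::'a. (max B 0 * norm v) * indicator (cball 0 (R + norm v)) x)"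
      by (intro integrable_mult_right integrable_real_indicator emeasure_lborel_cball_finite)
         simp
  qed (use lim dom in auto)
  moreover have "(LINT x|lborel. q n x) = 0" for n
    unfolding q_def
      integral_mult_left_zero Bochner_Integration.integral_diff[OF intfs intf]
    by (simp only: integral_lborel_translation[OF \<open>f \<in> borel_measurable borel\<close>]) simp
  ultimately show ?thesis
    by (simp add: LIMSEQ_const_iff)
qed

lemma partial_deriv_integral_zero:
  fixes f :: "real ^ 'd::finite \<Rightarrow> real"
  assumes f: "C1_fun f" and K: "compact K" and zero: "\<And>x. x \<notin> K \<Longrightarrow> f x = 0"
  shows "integrable lebesgue (partial_deriv i f)"
    and "(LINT x|lebesgue. partial_deriv i f x) = 0"
proof -
  obtain f' where f': "\<And>x. (f has_derivative blinfun_apply (f' x)) (at x)"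
    and cont: "continuous_on UNIV f'"
    using f unfolding C1_fun_def by blast
  have eq: "partial_deriv i f = (\<lambda>x. f' x (axis i 1))"
    using partial_deriv_eq[OF f'] by (simp add: fun_eq_iff)
  have "f' x (axis i 1) = 0" if "x \<notin> K" for x
    using has_derivative_zero_off_support[OF f' compact_imp_closed[OF K] zero that] by simp
  moreover have "continuous_on UNIV (\<lambda>x. f' x (axis i 1))"
    by (intro continuous_intros cont)
  ultimately have int: "integrable lborel (partial_deriv i f)"
    unfolding eq using integrable_continuous_compact_support[OF _ K] by blast
  then show "integrable lebesgue (partial_deriv i f)"
    by (simp add: integrable_completion)
  show "(LINT x|lebesgue. partial_deriv i f x) = 0"
    using int integral_directional_derivative_zero[OF f' cont K zero, of "axis i 1"]
    by (simp add: integral_completion eq)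
qed

text \<open>
  Away from the origin the coefficient is a product of continuous functions. At the origin, where
  the power of the norm may blow up, one factor \<open>|x|\<close> gained from \<open>|x\<^sub>i| \<le> |x|\<close> leaves the
  positive exponent \<open>\<alpha>/2\<close>.
\<close>

lemma continuous_on_herm_coeff:
  assumes \<alpha>: "\<alpha> > 0"
  shows "continuous_on UNIV (herm_coeff \<alpha> i)"
proof (rule continuous_at_imp_continuous_on, safe)
  fix x :: "real ^ 'a"
  show "isCont (herm_coeff \<alpha> i) x"
  proof (cases "x = 0")
    case False
    then show ?thesis
      unfolding herm_coeff_def by (intro continuous_intros) auto
  next
    case True
    have bound: "norm (herm_coeff \<alpha> i y) \<le> \<bar>sqrt (\<alpha> - 1)\<bar> * norm y powr (\<alpha> / 2)" for y :: "real ^ 'a"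
    proof -
      have "\<bar>y $ i\<bar> * norm y powr ((\<alpha> - 2) / 2) \<le> norm y * norm y powr ((\<alpha> - 2) / 2)"
        by (intro mult_right_mono component_le_norm_cart) simp
      also have "\<dots> = norm y powr (\<alpha> / 2)"
        by (cases "y = 0") (simp_all add: powr_mult_base diff_divide_distrib)
      finally show ?thesis
        by (simp add: herm_coeff_def abs_mult mult.assoc mult_left_mono)
    qed
    have "((\<lambda>y::real ^ 'a. \<bar>sqrt (\<alpha> - 1)\<bar> * norm y powr (\<alpha> / 2)) \<longlongrightarrow>
        \<bar>sqrt (\<alpha> - 1)\<bar> * (norm (0 :: real ^ 'a) powr (\<alpha> / 2))) (at 0)"
      using \<alpha> by (intro tendsto_intros) (auto intro: always_eventually)
    then have "((\<lambda>y::real ^ 'a. \<bar>sqrt (\<alpha> - 1)\<bar> * norm y powr (\<alpha> / 2)) \<longlongrightarrow> 0) (at 0)"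
      by simp
    then have "(herm_coeff \<alpha> i \<longlongrightarrow> 0) (at 0)"
      by (rule Lim_null_comparison[OF always_eventually, rotated]) (use bound in auto)
    then show ?thesis
      using True by (simp add: isCont_def herm_coeff_def)
  qed
qed

definition constraint_integrand ::
    "(nat \<Rightarrow> 'd::finite) \<Rightarrow> real \<Rightarrow> (real ^ 'd \<Rightarrow> real ^ ('d + 'd)) \<Rightarrow> real ^ 'd \<Rightarrow> real"
  where "constraint_integrand e \<alpha> \<phi> x =
    (\<Sum>k = 1..CARD('d). herm_coeff \<alpha> (e k) x * cmp e \<phi> (CARD('d) - k + 1) x) -
    (\<Sum>k = 1..CARD('d). herm_coeff \<alpha> (e k) x * cmp e \<phi> (CARD('d) + k) x)"

lemma div_herm_split:
  fixes e :: "nat \<Rightarrow> 'd::finite"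
  shows "div_herm e \<alpha> \<phi> x =
    (\<Sum>k = 1..CARD('d). partial_deriv (e k) (cmp e \<phi> (CARD('d) - k + 1)) x) +
    (\<Sum>k = 1..CARD('d). partial_deriv (e k) (cmp e \<phi> (CARD('d) + k)) x) +
    constraint_integrand e \<alpha> \<phi> x"
  by (simp add: div_herm_def constraint_integrand_def A_plus_def A_minus_def
      sum.distrib sum_subtractf)

lemma C1_fun_cmp:
  assumes "C1_fun \<phi>"
  shows "C1_fun (cmp e \<phi> j)"
  unfolding cmp_def[abs_def]
  by (rule C1_fun_bounded_linear_compose[OF bounded_linear_vec_nth assms])

lemma integrable_constraint_integrand:
  assumes \<phi>: "C1_fun \<phi>" and K: "compact K" and zero: "\<And>x. x \<notin> K \<Longrightarrow> \<phi> x = 0"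
    and \<alpha>: "\<alpha> > 0"
  shows "integrable lebesgue (constraint_integrand e \<alpha> \<phi>)"
proof -
  have "integrable lborel (constraint_integrand e \<alpha> \<phi>)"
  proof (rule integrable_continuous_compact_support[OF _ K])
    show "continuous_on UNIV (constraint_integrand e \<alpha> \<phi>)"
      unfolding constraint_integrand_def
      by (intro continuous_intros continuous_on_herm_coeff[OF \<alpha>] C1_fun_continuous
          C1_fun_cmp \<phi>)
  qed (simp add: constraint_integrand_def cmp_def zero)
  then show ?thesis
    by (simp add: integrable_completion)
qed

lemma restricted_fieldsD:
  assumes "\<phi> \<in> restricted_fields e \<alpha>"
  shows "C1_fun \<phi>" "compact (closure {x. \<phi> x \<noteq> 0})"
    "(LINT x|lebesgue. constraint_integrand e \<alpha> \<phi> x) = 0"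
  using assms by (auto simp: restricted_fields_def constraint_integrand_def)

lemma integral_div_herm_zero:
  assumes \<phi>: "\<phi> \<in> restricted_fields e \<alpha>" and \<alpha>: "\<alpha> > 0"
  shows "integrable lebesgue (div_herm e \<alpha> \<phi>)"
    and "(LINT x|lebesgue. div_herm e \<alpha> \<phi> x) = 0"
proof -
  note D = restricted_fieldsD[OF \<phi>]
  have zero: "\<phi> x = 0" if "x \<notin> closure {x. \<phi> x \<noteq> 0}" for x
    using that subsetD[OF closure_subset, of x "{x. \<phi> x \<noteq> 0}"] by auto
  have czero: "cmp e \<phi> j x = 0" if "x \<notin> closure {x. \<phi> x \<noteq> 0}" for j x
    using zero[OF that] by (simp add: cmp_def)
  note P = partial_deriv_integral_zero[OF C1_fun_cmp[OF D(1)] D(2) czero]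
  note Q = integrable_constraint_integrand[OF D(1,2) zero \<alpha>]
  have eq: "div_herm e \<alpha> \<phi> = (\<lambda>x.
    (\<Sum>k = 1..CARD('a). partial_deriv (e k) (cmp e \<phi> (CARD('a) - k + 1)) x) +
    (\<Sum>k = 1..CARD('a). partial_deriv (e k) (cmp e \<phi> (CARD('a) + k)) x) +
    constraint_integrand e \<alpha> \<phi> x)"
    by (rule ext) (rule div_herm_split)
  show "integrable lebesgue (div_herm e \<alpha> \<phi>)"
    unfolding eq
    by (intro Bochner_Integration.integrable_add Bochner_Integration.integrable_sum P(1) Q)
  show "(LINT x|lebesgue. div_herm e \<alpha> \<phi> x) = 0"
    unfolding eq
    using P Q D(3)
    by (simp add: Bochner_Integration.integral_add Bochner_Integration.integral_sum
        Bochner_Integration.integrable_add Bochner_Integration.integrable_sum)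
qed

lemma cmp_uminus: "cmp e (\<lambda>x. - \<phi> x) j = (\<lambda>x. - cmp e \<phi> j x)"
  by (simp add: cmp_def fun_eq_iff)

lemma C1_fun_partial_deriv_uminus:
  assumes "C1_fun f"
  shows "partial_deriv i (\<lambda>x. - f x) x = - partial_deriv i f x"
proof -
  obtain f' where "(f has_derivative f') (at x)"
    using assms unfolding C1_fun_def by blast
  then show ?thesis
    using partial_deriv_eq has_derivative_minus by metis
qed

lemma div_herm_uminus:
  assumes "C1_fun \<phi>"
  shows "div_herm e \<alpha> (\<lambda>x. - \<phi> x) x = - div_herm e \<alpha> \<phi> x"
  by (simp add: div_herm_split constraint_integrand_def cmp_uminus
      C1_fun_partial_deriv_uminus[OF C1_fun_cmp[OF assms]] sum_negf)

lemma restricted_fields_uminus: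
  assumes "\<phi> \<in> restricted_fields e \<alpha>"
  shows "(\<lambda>x. - \<phi> x) \<in> restricted_fields e \<alpha>"
proof -
  note D = restricted_fieldsD[OF assms]
  have "C1_fun (\<lambda>x. - \<phi> x)"
    by (rule C1_fun_bounded_linear_compose[OF bounded_linear_minus[OF bounded_linear_ident] D(1)])
  moreover have "constraint_integrand e \<alpha> (\<lambda>x. - \<phi> x) = (\<lambda>x. - constraint_integrand e \<alpha> \<phi> x)"
    by (simp add: constraint_integrand_def cmp_uminus sum_negf fun_eq_iff)
  then have "(LINT x|lebesgue. constraint_integrand e \<alpha> (\<lambda>x. - \<phi> x) x) = 0"
    using D(3) by simp
  ultimately show ?thesis
    using assms by (simp add: restricted_fields_def constraint_integrand_def)
qed

lemma set_integral_div_herm_Compl: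
  assumes \<phi>: "\<phi> \<in> restricted_fields e \<alpha>" and \<alpha>: "\<alpha> > 0" and E: "E \<in> sets lebesgue"
  shows "(LINT x:- E|lebesgue. div_herm e \<alpha> \<phi> x) =
    (LINT x:E|lebesgue. div_herm e \<alpha> (\<lambda>x. - \<phi> x) x)"
proof -
  note I = integral_div_herm_zero[OF \<phi> \<alpha>]
  have "integrable lebesgue (\<lambda>x. indicator E x *\<^sub>R div_herm e \<alpha> \<phi> x)"
    by (rule integrable_mult_indicator[OF E I(1)])
  moreover have "indicator (- E) x *\<^sub>R div_herm e \<alpha> \<phi> x =
      div_herm e \<alpha> \<phi> x - indicator E x *\<^sub>R div_herm e \<alpha> \<phi> x" for x
    by (simp add: indicator_def)
  ultimately show ?thesis
    using I by (simp add: set_lebesgue_integral_def div_herm_uminus[OF restricted_fieldsD(1)[OF \<phi>]])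
qed

lemma restricted_perimeter_Compl_le:
  assumes "\<alpha> > 0" and "E \<in> sets lebesgue"
  shows "restricted_perimeter e \<alpha> (- E) \<le> restricted_perimeter e \<alpha> E"
  unfolding restricted_perimeter_def
proof (rule SUP_mono)
  fix \<phi> assume \<phi>: "\<phi> \<in> restricted_fields e \<alpha>"
  show "\<exists>\<psi>\<in>restricted_fields e \<alpha>. ereal (LINT x:- E|lebesgue. div_herm e \<alpha> \<phi> x)
      \<le> ereal (LINT x:E|lebesgue. div_herm e \<alpha> \<psi> x)"
    by (rule bexI[OF _ restricted_fields_uminus[OF \<phi>]])
       (simp only: set_integral_div_herm_Compl[OF \<phi> assms] order_refl)
qed

theorem lemma1p16:
  fixes e :: "nat \<Rightarrow> 'd::finite" and \<alpha> :: real and E :: "(real ^ 'd) set"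
  assumes "bij_betw e {1..CARD('d)} (UNIV :: 'd set)"
    and "CARD('d) \<ge> 2"
    and "\<alpha> \<ge> 1"
    and "E \<in> sets lebesgue"
    and "restricted_perimeter e \<alpha> E < \<infinity>"
  shows "restricted_perimeter e \<alpha> E = restricted_perimeter e \<alpha> (- E)"
proof (rule antisym)
  have \<alpha>: "\<alpha> > 0" using assms(3) by simp
  have "- E \<in> sets lebesgue"
    using sets.compl_sets[OF assms(4)] by (simp flip: Compl_eq_Diff_UNIV)
  from restricted_perimeter_Compl_le[OF \<alpha> this]
  show "restricted_perimeter e \<alpha> E \<le> restricted_perimeter e \<alpha> (- E)" by simp
  show "restricted_perimeter e \<alpha> (- E) \<le> restricted_perimeter e \<alpha> E"
    by (rule restricted_perimeter_Compl_le[OF \<alpha> assms(4)])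
qed

end
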